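(* Let $G$ be a graph with $n$ vertices. Then $$2\sqrt{\sum_{v_iv_j\in E}\frac{d_i^2+d_j^2}{(d_i+d_j)^2}}\leq E_{DSO}(G)\leq\sqrt{2n\sum_{v_iv_j\in E}\frac{d_i^2+d_j^2}{(d_i+d_j)^2}}.$$ Equality on the right-hand side holds if and only if $G$ is a graph without edges or all its vertices have degree one. For connected $G$, equality on the left-hand side holds if and only if $G$ is a complete bipartite graph.
   Context: All graphs are finite, simple and undirected; $E$ is the edge set and $d_i=d_{v_i}$ the degree of $v_i$. For a graph $G$ with vertices $v_1,\dots,v_n$, the diminished Sombor matrix $M_{DS}(G)=(\mu_{ij})$ is the $n\times n$ real symmetric matrix with $\mu_{ij}=\frac{\sqrt{d_i^2+d_j^2}}{d_i+d_j}$ if $v_iv_j\in E$, and $\mu_{ij}=0$ otherwise. If $\lambda_1\geq\cdots\geq\lambda_n$ are its eigenvalues, the diminished Sombor energy is $E_{DSO}(G)=\sum_{i=1}^n|\lambda_i|$. *)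

theory Defs
  imports "Graph_Theory.Graph_Theory" "Jordan_Normal_Form.Char_Poly"
begin

text \<open>
  A finite simple undirected graph is represented, as in the Graph Theory library, by a finite
  loop-free symmetric digraph without parallel arcs (locale \<open>graph\<close>): every edge $uv$ is a pair
  of opposite arcs. So \<open>u \<rightarrow>\<^bsub>G\<^esub> v\<close> is adjacency and the out-degree of a vertex is
  its degree, but a sum over \<open>arcs G\<close> would count each edge twice; \<open>edges\<close> collects the
  undirected edges, each as the set of its two end points.
\<close>

definition edges :: "('a, 'b) pre_digraph \<Rightarrow> 'a set set" where
  "edges G = {{u, v} | u v. u \<rightarrow>\<^bsub>G\<^esub> v}"

abbreviation deg :: "('a, 'b) pre_digraph \<Rightarrow> 'a \<Rightarrow> real" where
  "deg G v \<equiv> real (out_degree G v)"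

text \<open>The list \<open>vs\<close> is the enumeration $v_1,\dots,v_n$ of the vertices, with indices from 0.\<close>

definition diminished_sombor_matrix :: "('a, 'b) pre_digraph \<Rightarrow> 'a list \<Rightarrow> real mat" where
  "diminished_sombor_matrix G vs = mat (length vs) (length vs) (\<lambda>(i, j).
     if vs ! i \<rightarrow>\<^bsub>G\<^esub> vs ! j
     then sqrt ((deg G (vs ! i))\<^sup>2 + (deg G (vs ! j))\<^sup>2) / (deg G (vs ! i) + deg G (vs ! j))
     else 0)"

text \<open>
  Eigenvalues are taken with algebraic multiplicity, as the multiset of real roots of the
  characteristic polynomial. The matrix is real symmetric if \<open>G\<close> is a graph, so this polynomial
  splits over the reals and the multiset consists of all $n$ eigenvalues.
\<close>

definition diminished_sombor_energy :: "('a, 'b) pre_digraph \<Rightarrow> 'a list \<Rightarrow> real" where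
  "diminished_sombor_energy G vs = (\<Sum>x\<in>#proots (char_poly (diminished_sombor_matrix G vs)). \<bar>x\<bar>)"

text \<open>
  For an edge $e = uv$ the summand below is $(d_u^2 + d_v^2) / (d_u + d_v)^2$; writing both sums
  over the two-element set \<open>e\<close> makes the symmetry in $u$ and $v$ evident.
\<close>

definition diminished_sombor_edge_sum :: "('a, 'b) pre_digraph \<Rightarrow> real" where
  "diminished_sombor_edge_sum G = (\<Sum>e\<in>edges G. (\<Sum>v\<in>e. (deg G v)\<^sup>2) / (\<Sum>v\<in>e. deg G v)\<^sup>2)"

text \<open>As in the library, one part may be empty; thus the one-vertex graph is $K_{1,0}$.\<close>

definition complete_bipartite :: "('a, 'b) pre_digraph \<Rightarrow> bool" where
  "complete_bipartite G \<longleftrightarrow> (\<exists>p q. complete_bipartite_digraph p q G)"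

end

theory Submission
  imports Defs "Jordan_Normal_Form.Schur_Decomposition"
begin

text \<open>
  The matrix $M$ is real symmetric with zero diagonal, so its eigenvalues satisfy
  $\sum\lambda_i = 0$ and $\sum\lambda_i^2 = 2S$, where $S$ is the edge sum. The upper bound is
  Cauchy--Schwarz, with equality iff all $\lambda_i^2$ agree, that is, iff $M^2$ is scalar; as $M$ is
  nonnegative, this forbids two distinct neighbours of a vertex. The lower bound follows from
  $(\sum|\lambda_i|)^2 + (\sum\lambda_i)^2 = 2\sum\lambda_i^2 + \sum_{i\ne j}(|\lambda_i\lambda_j| + \lambda_i\lambda_j)$,
  and equality forces the spectrum $a, -a, 0, \dots, 0$. Then $M^2 + aM$ and $M^2 - aM$ have rank one;
  since $M$ has zero diagonal, vanishing of their minors makes non-adjacency an equivalence relation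
  with at most two classes. Conversely a complete bipartite graph satisfies $M^3 = SM$.

  No orthonormal eigenbasis is needed: polynomials in $M$ are triangularised simultaneously, and a
  symmetric $X$ with eigenvalues $d_i$ satisfies $\sum_{i,j} X_{ij}^2 = \sum_i d_i^2$, so it vanishes as
  soon as its eigenvalues do.
\<close>

section \<open>Traces and simultaneous triangular forms\<close>

lemma mult_mat_sum:
  assumes "A \<in> carrier_mat n m" "B \<in> carrier_mat m k" "i < n" "j < k"
  shows "(A * B) $$ (i, j) = (\<Sum>l<m. A $$ (i, l) * B $$ (l, j))"
  using assms by (simp add: scalar_prod_def atLeast0LessThan)

definition mat_trace :: "'a::comm_monoid_add mat \<Rightarrow> 'a" where
  "mat_trace A = (\<Sum>i<dim_row A. A $$ (i, i))"

lemma mat_trace_comm: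
  fixes A B :: "'a::comm_semiring_0 mat"
  assumes "A \<in> carrier_mat n m" "B \<in> carrier_mat m n"
  shows "mat_trace (A * B) = mat_trace (B * A)"
proof -
  have "mat_trace (A * B) = (\<Sum>i<n. \<Sum>j<m. A $$ (i, j) * B $$ (j, i))"
    using assms by (auto simp: mat_trace_def mult_mat_sum[OF assms] simp del: index_mult_mat(1) intro!: sum.cong)
  also have "\<dots> = (\<Sum>j<m. \<Sum>i<n. B $$ (j, i) * A $$ (i, j))"
    by (subst sum.swap) (simp add: mult.commute)
  also have "\<dots> = mat_trace (B * A)"
    using assms by (auto simp: mat_trace_def mult_mat_sum[OF assms(2,1)] simp del: index_mult_mat(1) intro!: sum.cong)
  finally show ?thesis .
qed

section \<open>Simultaneous upper triangular forms\<close>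

locale inverse_pair =
  fixes n :: nat and P Q :: "real mat"
  assumes P: "P \<in> carrier_mat n n" and Q: "Q \<in> carrier_mat n n"
    and PQ: "P * Q = 1\<^sub>m n" and QP: "Q * P = 1\<^sub>m n"
begin

text \<open>The same \<open>P\<close> and \<open>Q\<close> serve every matrix, and \<open>d\<close>
  keeps the diagonal in a fixed order. Hence the diagonals of sums, multiples and products are
  computed index by index, which a mere multiset of eigenvalues would not allow.\<close>

definition triangular_form :: "real mat \<Rightarrow> (nat \<Rightarrow> real) \<Rightarrow> bool" where
  "triangular_form X d \<longleftrightarrow> X \<in> carrier_mat n n \<and>
     (\<exists>T \<in> carrier_mat n n. upper_triangular T \<and> (\<forall>i<n. T $$ (i, i) = d i) \<and> X = P * T * Q)"

lemma triangular_form_carrier: "triangular_form X d \<Longrightarrow> X \<in> carrier_mat n n"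
  by (simp add: triangular_form_def)

lemma triangular_formI:
  assumes "T \<in> carrier_mat n n" "upper_triangular T" "\<And>i. i < n \<Longrightarrow> T $$ (i, i) = d i" "X = P * T * Q"
  shows "triangular_form X d"
proof -
  have "X \<in> carrier_mat n n"
    unfolding assms(4) by (rule mult_carrier_mat[OF mult_carrier_mat[OF P assms(1)] Q])
  then show ?thesis
    using assms unfolding triangular_form_def by blast
qed

lemma triangular_form_one: "triangular_form (1\<^sub>m n) (\<lambda>_. 1)"
  by (rule triangular_formI[of "1\<^sub>m n"]) (simp_all add: right_mult_one_mat[OF P] PQ)

lemma triangular_form_smult:
  assumes "triangular_form X d"
  shows "triangular_form (c \<cdot>\<^sub>m X) (\<lambda>i. c * d i)"
proof -
  obtain T where T: "T \<in> carrier_mat n n" "upper_triangular T"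
    "\<forall>i<n. T $$ (i, i) = d i" "X = P * T * Q"
    using assms unfolding triangular_form_def by blast
  have "c \<cdot>\<^sub>m X = P * (c \<cdot>\<^sub>m T) * Q"
    unfolding T(4) by (simp only: mult_smult_distrib[OF P T(1)]
        mult_smult_assoc_mat[OF mult_carrier_mat[OF P T(1)] Q])
  then show ?thesis
    by (intro triangular_formI[of "c \<cdot>\<^sub>m T"]) (use T(1-3) in \<open>auto simp: upper_triangular_def\<close>)
qed

lemma triangular_form_add:
  assumes "triangular_form X d" "triangular_form Y e"
  shows "triangular_form (X + Y) (\<lambda>i. d i + e i)"
proof -
  obtain T where T: "T \<in> carrier_mat n n" "upper_triangular T"
    "\<forall>i<n. T $$ (i, i) = d i" "X = P * T * Q"
    using assms(1) unfolding triangular_form_def by blast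
  obtain U where U: "U \<in> carrier_mat n n" "upper_triangular U"
    "\<forall>i<n. U $$ (i, i) = e i" "Y = P * U * Q"
    using assms(2) unfolding triangular_form_def by blast
  have "X + Y = P * (T + U) * Q"
    unfolding T(4) U(4) by (simp only: mult_add_distrib_mat[OF P T(1) U(1)]
        add_mult_distrib_mat[OF mult_carrier_mat[OF P T(1)] mult_carrier_mat[OF P U(1)] Q])
  then show ?thesis
    by (intro triangular_formI[of "T + U"]) (use T(1-3) U(1-3) in \<open>auto simp: upper_triangular_def\<close>)
qed

text \<open>The inner factor \<open>Q * P\<close> cancels, and upper triangular matrices are closed
  under products, with diagonals multiplying entrywise.\<close>

lemma triangular_form_mult:
  assumes "triangular_form X d" "triangular_form Y e"
  shows "triangular_form (X * Y) (\<lambda>i. d i * e i)"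
proof -
  obtain T where T: "T \<in> carrier_mat n n" "upper_triangular T"
    "\<forall>i<n. T $$ (i, i) = d i" "X = P * T * Q"
    using assms(1) unfolding triangular_form_def by blast
  obtain U where U: "U \<in> carrier_mat n n" "upper_triangular U"
    "\<forall>i<n. U $$ (i, i) = e i" "Y = P * U * Q"
    using assms(2) unfolding triangular_form_def by blast
  note tu = T(1) U(1)
  have PT: "P * T \<in> carrier_mat n n" and UQ: "U * Q \<in> carrier_mat n n"
    using P Q tu by auto
  have "X * Y = (P * T) * Q * (P * (U * Q))"
    by (simp only: T(4) U(4) assoc_mult_mat[OF P U(1) Q])
  also have "\<dots> = (P * T) * (Q * (P * (U * Q)))"
    by (rule assoc_mult_mat[OF PT Q, of _ n]) (use P UQ in auto)
  also have "Q * (P * (U * Q)) = (Q * P) * (U * Q)"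
    by (rule assoc_mult_mat[symmetric, OF Q P UQ])
  also have "\<dots> = U * Q"
    by (simp only: QP left_mult_one_mat[OF UQ])
  also have "P * T * (U * Q) = P * T * U * Q"
    by (rule assoc_mult_mat[symmetric, OF PT U(1) Q])
  also have "P * T * U = P * (T * U)"
    by (rule assoc_mult_mat[OF P tu])
  finally have XY: "X * Y = P * (T * U) * Q" .
  have entry: "(T * U) $$ (i, j) = (\<Sum>k<n. T $$ (i, k) * U $$ (k, j))" if "i < n" "j < n" for i j
    using that by (rule mult_mat_sum[OF tu])
  have "upper_triangular (T * U)"
  proof (rule upper_triangularI)
    fix i j assume ij: "j < i" "i < dim_row (T * U)"
    \<comment> \<open>Below the diagonal every \<open>k\<close> satisfies \<open>k < i\<close>,
      which kills the factor from \<open>T\<close>, or \<open>j < i \<le> k\<close>, which kills the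
      factor from \<open>U\<close>.\<close>
    have "T $$ (i, k) * U $$ (k, j) = 0" if "k < n" for k
    proof (cases "k < i")
      case True
      then show ?thesis using upper_triangularD[OF T(2)] tu ij by simp
    next
      case False
      then show ?thesis using upper_triangularD[OF U(2)] tu ij that by simp
    qed
    then have "(\<Sum>k<n. T $$ (i, k) * U $$ (k, j)) = 0"
      by (intro sum.neutral) simp
    then show "(T * U) $$ (i, j) = 0"
      using entry[of i j] ij tu by (simp del: index_mult_mat(1))
  qed
  moreover have "(T * U) $$ (i, i) = d i * e i" if "i < n" for i
  proof -
    have "T $$ (i, k) * U $$ (k, i) = (if k = i then d i * e i else 0)" if "k < n" for k
      using upper_triangularD[OF T(2), of k i] upper_triangularD[OF U(2), of i k] tu T(3) U(3)
        that \<open>i < n\<close> by (cases k i rule: linorder_cases) auto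
    then show ?thesis
      using entry[OF that that] that by simp
  qed
  ultimately show ?thesis
    by (intro triangular_formI[OF _ _ _ XY]) (use tu in auto)
qed

text \<open>Cyclicity of the trace brings \<open>Q\<close> next to \<open>P\<close>, where they
  cancel.\<close>

lemma triangular_form_trace:
  assumes "triangular_form X d"
  shows "mat_trace X = (\<Sum>i<n. d i)"
proof -
  obtain T where T: "T \<in> carrier_mat n n" "upper_triangular T"
    "\<forall>i<n. T $$ (i, i) = d i" "X = P * T * Q"
    using assms unfolding triangular_form_def by blast
  have "mat_trace X = mat_trace (Q * (P * T))"
    unfolding T(4) by (rule mat_trace_comm) (use T(1) P Q in auto)
  also have "Q * (P * T) = T"
    by (metis assoc_mult_mat[OF Q P T(1)] QP left_mult_one_mat[OF T(1)])
  also have "mat_trace T = (\<Sum>i<n. d i)"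
    using T(1,3) by (simp add: mat_trace_def)
  finally show ?thesis .
qed

text \<open>Both sides are the trace of \<open>X * X\<close>: on the left by symmetry of
  \<open>X\<close>, on the right because \<open>X * X\<close> has the diagonal
  \<open>d i * d i\<close> in triangular form.\<close>

lemma frobenius_norm_triangular_form:
  assumes "triangular_form X d" and s: "\<And>i j. i < n \<Longrightarrow> j < n \<Longrightarrow> X $$ (j, i) = X $$ (i, j)"
  shows "(\<Sum>i<n. \<Sum>j<n. (X $$ (i, j))\<^sup>2) = (\<Sum>i<n. (d i)\<^sup>2)"
proof -
  have X: "X \<in> carrier_mat n n"
    using assms(1) by (rule triangular_form_carrier)
  have "(\<Sum>i<n. (d i)\<^sup>2) = mat_trace (X * X)"
    using triangular_form_trace[OF triangular_form_mult[OF assms(1) assms(1)]]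
    by (simp add: power2_eq_square)
  also have "\<dots> = (\<Sum>i<n. \<Sum>j<n. (X $$ (i, j))\<^sup>2)"
    using X s by (auto simp: mat_trace_def mult_mat_sum[OF X X] power2_eq_square simp del: index_mult_mat(1) intro!: sum.cong)
  finally show ?thesis ..
qed

text \<open>This stands in for diagonalisability: polynomial identities between the eigenvalues
  become identities between symmetric matrices, and conversely.\<close>

lemma triangular_form_eq_0_iff:
  assumes X: "triangular_form X d"
    and sym: "\<And>i j. i < n \<Longrightarrow> j < n \<Longrightarrow> X $$ (j, i) = X $$ (i, j)"
  shows "(\<forall>i<n. d i = 0) \<longleftrightarrow> (\<forall>i<n. \<forall>j<n. X $$ (i, j) = 0)"
proof -
  have "(\<forall>i<n. d i = 0) \<longleftrightarrow> (\<Sum>i<n. (d i)\<^sup>2) = 0"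
    by (auto simp: sum_nonneg_eq_0_iff)
  also have "(\<Sum>i<n. (d i)\<^sup>2) = (\<Sum>i<n. \<Sum>j<n. (X $$ (i, j))\<^sup>2)"
    by (rule frobenius_norm_triangular_form[OF X sym, symmetric])
  also have "\<dots> = 0 \<longleftrightarrow> (\<forall>i<n. \<forall>j<n. X $$ (i, j) = 0)"
    by (simp add: sum_nonneg_eq_0_iff sum_nonneg Ball_def)
  finally show ?thesis .
qed

end

section \<open>Eigenvalues of real symmetric matrices\<close>

text \<open>For an eigenvector \<open>v\<close>, the Hermitian form \<open>w\<close> of
  \<open>A\<close> at \<open>v\<close> equals \<open>a\<close> times the squared norm of
  \<open>v\<close>. Symmetry makes \<open>w\<close> its own conjugate, and the norm is
  nonzero.\<close>

lemma eigenvalue_real_symmetric: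
  assumes A: "A \<in> carrier_mat n n"
    and sym: "\<And>i j. i < n \<Longrightarrow> j < n \<Longrightarrow> A $$ (j, i) = A $$ (i, j)"
    and ev: "eigenvalue (map_mat complex_of_real A) a"
  shows "a \<in> \<real>"
proof -
  obtain v where v: "v \<in> carrier_vec n" "v \<noteq> 0\<^sub>v n" "map_mat complex_of_real A *\<^sub>v v = a \<cdot>\<^sub>v v"
    using ev A unfolding eigenvalue_def eigenvector_def by auto
  define S where "S = (\<Sum>i<n. (cmod (v $ i))\<^sup>2)"
  define w where "w = (\<Sum>i<n. \<Sum>j<n. cnj (v $ i) * of_real (A $$ (i, j)) * v $ j)"
  have "(\<Sum>j<n. of_real (A $$ (i, j)) * v $ j) = a * v $ i" if "i < n" for i
  proof -
    have "(map_mat complex_of_real A *\<^sub>v v) $ i = (\<Sum>j<n. of_real (A $$ (i, j)) * v $ j)"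
      using A v(1) that by (auto simp: scalar_prod_def atLeast0LessThan intro!: sum.cong)
    then show ?thesis using v(1) that unfolding v(3) by simp
  qed
  then have "w = (\<Sum>i<n. cnj (v $ i) * (a * v $ i))"
    by (simp add: w_def mult.assoc flip: sum_distrib_left)
  also have "\<dots> = a * of_real S"
    unfolding S_def of_real_sum sum_distrib_left
    by (intro sum.cong refl) (simp add: complex_norm_square algebra_simps del: of_real_power)
  finally have w: "w = a * of_real S" .
  have "cnj w = (\<Sum>i<n. \<Sum>j<n. v $ i * of_real (A $$ (i, j)) * cnj (v $ j))"
    by (simp add: w_def)
  also have "\<dots> = w"
    unfolding w_def by (subst sum.swap) (auto simp: sym intro!: sum.cong)
  finally have "w \<in> \<real>" by (simp add: Reals_cnj_iff)
  moreover have "S \<noteq> 0"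
  proof
    assume "S = 0"
    then have "v $ i = 0" if "i < n" for i
      using that by (simp add: S_def sum_nonneg_eq_0_iff)
    then have "v = 0\<^sub>v n" using v(1) by (intro eq_vecI) auto
    with v(2) show False ..
  qed
  ultimately show ?thesis
    using w by (metis Reals_divide Reals_of_real nonzero_mult_div_cancel_right of_real_eq_0_iff)
qed

text \<open>Over the complex numbers the polynomial splits with real roots only; the factorisation
  descends because the coefficient embedding is injective on polynomials.\<close>

lemma char_poly_real_symmetric_splits:
  assumes A: "A \<in> carrier_mat n n"
    and sym: "\<And>i j. i < n \<Longrightarrow> j < n \<Longrightarrow> A $$ (j, i) = A $$ (i, j)"
  obtains es :: "real list" where "char_poly A = (\<Prod>e\<leftarrow>es. [:- e, 1:])" "length es = n"
proof -
  interpret of_real_poly: map_poly_inj_idom_hom "of_real :: real \<Rightarrow> complex" ..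
  let ?C = "map_mat complex_of_real A"
  have C: "?C \<in> carrier_mat n n" using A by simp
  obtain as where as: "char_poly ?C = (\<Prod>a\<leftarrow>as. [:- a, 1:])" "length as = n"
    using char_poly_factorized[OF C] by blast
  have "a \<in> \<real>" if "a \<in> set as" for a
  proof (rule eigenvalue_real_symmetric[OF A sym])
    show "eigenvalue ?C a"
      using that by (auto simp: eigenvalue_root_char_poly[OF C] as poly_prod_list prod_list_zero_iff)
  qed
  then have as_real: "map (\<lambda>a. of_real (Re a)) as = as"
    by (intro map_idI) (auto elim: Reals_cases)
  have "map_poly of_real (\<Prod>e\<leftarrow>map Re as. [:- e, 1:]) = (\<Prod>a\<leftarrow>map (\<lambda>a. complex_of_real (Re a)) as. [:- a, 1:])"
    by (simp add: of_real_poly.hom_prod_list o_def)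
  also have "\<dots> = map_poly of_real (char_poly A)"
    unfolding as_real as(1)[symmetric] by (rule of_real_hom.char_poly_hom[OF A])
  finally have "char_poly A = (\<Prod>e\<leftarrow>map Re as. [:- e, 1:])"
    by (simp only: of_real_poly.eq_iff)
  then show ?thesis
    by (rule that) (simp add: as)
qed

lemma proots_prod_list_linear_factors:
  fixes es :: "'a::idom list"
  shows "proots (\<Prod>e\<leftarrow>es. [:- e, 1:]) = mset es"
proof (induction es)
  case (Cons e es)
  have "(\<Prod>e\<leftarrow>es. [:- e, 1:]) \<noteq> 0"
    by (auto simp: prod_list_zero_iff)
  then show ?case
    using Cons by (simp add: proots_mult del: mult_pCons_left)
qed simp

text \<open>Schur decomposition accepts a prescribed order of the eigenvalues, so one list
  \<open>es\<close> is both the diagonal of the triangular form and the multiset of roots that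
  defines the energy.\<close>

lemma real_symmetric_triangular_form:
  assumes A: "A \<in> carrier_mat n n"
    and sym: "\<And>i j. i < n \<Longrightarrow> j < n \<Longrightarrow> A $$ (j, i) = A $$ (i, j)"
  obtains P Q es where "inverse_pair n P Q" "inverse_pair.triangular_form n P Q A (\<lambda>i. es ! i)"
    "length es = n" "proots (char_poly A) = mset es"
proof -
  obtain es where es: "char_poly A = (\<Prod>e\<leftarrow>es. [:- e, 1:])" "length es = n"
    by (rule char_poly_real_symmetric_splits[OF A sym])
  obtain T P Q where "schur_decomposition A es = (T, P, Q)"
    by (metis prod_cases3)
  from schur_decomposition[OF A es(1) this]
  have wit: "similar_mat_wit A T P Q" and T: "upper_triangular T" and diag: "diag_mat T = es"
    by auto
  note w = similar_mat_witD2[OF A wit]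
  interpret inverse_pair n P Q
    by unfold_locales (fact w)+
  have "triangular_form A (\<lambda>i. es ! i)"
    by (rule triangular_formI[OF w(5) T _ w(3)]) (use w(5) in \<open>auto simp: diag[symmetric] diag_mat_def\<close>)
  moreover have "proots (char_poly A) = mset es"
    by (simp add: es proots_prod_list_linear_factors)
  ultimately show ?thesis
    using inverse_pair_axioms es(2) that by blast
qed

section \<open>Sums of absolute values and rank one\<close>

text \<open>Used twice: with \<open>b\<close> constantly 1 it is Cauchy--Schwarz with its defect,
  and with two columns of a matrix it sums the squares of their 2 by 2 minors.\<close>

lemma lagrange_identity:
  fixes a b :: "'i \<Rightarrow> real"
  shows "(\<Sum>i\<in>I. \<Sum>k\<in>I. (a i * b k - b i * a k)\<^sup>2) =
    2 * ((\<Sum>i\<in>I. (a i)\<^sup>2) * (\<Sum>i\<in>I. (b i)\<^sup>2) - (\<Sum>i\<in>I. a i * b i)\<^sup>2)"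
proof -
  have "(\<Sum>i\<in>I. \<Sum>k\<in>I. (a i * b k - b i * a k)\<^sup>2) =
      (\<Sum>i\<in>I. \<Sum>k\<in>I. (a i)\<^sup>2 * (b k)\<^sup>2) + (\<Sum>i\<in>I. \<Sum>k\<in>I. (b i)\<^sup>2 * (a k)\<^sup>2)
      - 2 * (\<Sum>i\<in>I. \<Sum>k\<in>I. (a i * b i) * (a k * b k))"
    unfolding sum_distrib_left sum.distrib[symmetric] sum_subtractf[symmetric]
    by (intro sum.cong refl) (simp add: power2_eq_square algebra_simps)
  then show ?thesis
    by (simp add: sum_product[symmetric] power2_eq_square)
qed

text \<open>Adding the vanishing square of \<open>\<Sum>i\<in>I. e i\<close> turns each product of
  absolute values into \<open>\<bar>t\<bar> + t\<close> with \<open>t = e i * e j\<close>; the terms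
  with \<open>i = j\<close> give \<open>2 * (e i)\<^sup>2\<close>.\<close>

lemma power2_sum_abs:
  fixes e :: "'i \<Rightarrow> real"
  assumes "finite I" "(\<Sum>i\<in>I. e i) = 0"
  shows "(\<Sum>i\<in>I. \<bar>e i\<bar>)\<^sup>2 =
    2 * (\<Sum>i\<in>I. (e i)\<^sup>2) + (\<Sum>i\<in>I. \<Sum>j\<in>I - {i}. \<bar>e i * e j\<bar> + e i * e j)"
proof -
  have "(\<Sum>i\<in>I. \<bar>e i\<bar>)\<^sup>2 = (\<Sum>i\<in>I. \<bar>e i\<bar>)\<^sup>2 + (\<Sum>i\<in>I. e i)\<^sup>2"
    using assms by simp
  also have "\<dots> = (\<Sum>i\<in>I. \<Sum>j\<in>I. \<bar>e i * e j\<bar> + e i * e j)"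
    by (simp add: power2_eq_square sum_product sum.distrib abs_mult)
  also have "\<dots> = (\<Sum>i\<in>I. 2 * (e i)\<^sup>2 + (\<Sum>j\<in>I - {i}. \<bar>e i * e j\<bar> + e i * e j))"
    using assms(1) by (intro sum.cong refl) (simp add: sum.remove power2_eq_square)
  finally show ?thesis
    by (simp add: sum.distrib sum_distrib_left)
qed

lemma sum_abs_lower_bound:
  fixes e :: "'i \<Rightarrow> real"
  assumes "finite I" "(\<Sum>i\<in>I. e i) = 0" "(\<Sum>i\<in>I. (e i)\<^sup>2) = 2 * s"
  shows "2 * sqrt s \<le> (\<Sum>i\<in>I. \<bar>e i\<bar>)"
proof -
  have s: "0 \<le> s"
    using sum_nonneg[of I "\<lambda>i. (e i)\<^sup>2"] assms(3) by simp
  have "0 \<le> (\<Sum>i\<in>I. \<Sum>j\<in>I - {i}. \<bar>e i * e j\<bar> + e i * e j)"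
  proof (intro sum_nonneg)
    show "0 \<le> \<bar>e i * e j\<bar> + e i * e j" for i j by linarith
  qed
  then have "(2 * sqrt s)\<^sup>2 \<le> (\<Sum>i\<in>I. \<bar>e i\<bar>)\<^sup>2"
    using power2_sum_abs[OF assms(1,2)] assms(3) s by (simp add: power_mult_distrib)
  then show ?thesis
    by (rule power2_le_imp_le) (simp add: sum_nonneg)
qed

text \<open>Equality makes the nonnegative off-diagonal terms \<open>\<bar>t\<bar> + t\<close> sum
  to zero, so each vanishes, which means \<open>t \<le> 0\<close>.\<close>

lemma sum_abs_lower_bound_eqD:
  fixes e :: "'i \<Rightarrow> real"
  assumes "finite I" "(\<Sum>i\<in>I. e i) = 0" "(\<Sum>i\<in>I. (e i)\<^sup>2) = 2 * s"
    and eq: "2 * sqrt s = (\<Sum>i\<in>I. \<bar>e i\<bar>)"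
    and "i \<in> I" "j \<in> I" "i \<noteq> j"
  shows "e i * e j \<le> 0"
proof -
  have nonneg: "0 \<le> \<bar>e i * e j\<bar> + e i * e j" for i j
    by linarith
  have "0 \<le> s"
    using sum_nonneg[of I "\<lambda>i. (e i)\<^sup>2"] assms(3) by simp
  then have "(\<Sum>i\<in>I. \<Sum>j\<in>I - {i}. \<bar>e i * e j\<bar> + e i * e j) = 0"
    using power2_sum_abs[OF assms(1,2)] assms(3) by (simp add: eq[symmetric] power_mult_distrib)
  from sum_nonneg_0[OF assms(1) sum_nonneg[OF nonneg] this \<open>i \<in> I\<close>]
  have "(\<Sum>j\<in>I - {i}. \<bar>e i * e j\<bar> + e i * e j) = 0" .
  from sum_nonneg_0[OF _ nonneg this, of j] have "\<bar>e i * e j\<bar> + e i * e j = 0"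
    using assms by simp
  then show ?thesis by linarith
qed

lemma sum_abs_upper_bound:
  fixes e :: "'i \<Rightarrow> real"
  shows "(\<Sum>i\<in>I. \<bar>e i\<bar>) \<le> sqrt (card I * (\<Sum>i\<in>I. (e i)\<^sup>2))"
proof (rule real_le_rsqrt)
  \<comment> \<open>The factors 1 are written out so that the term matches the left side of the
    Lagrange identity for the second family constantly 1.\<close>
  have "0 \<le> (\<Sum>i\<in>I. \<Sum>k\<in>I. (\<bar>e i\<bar> * 1 - 1 * \<bar>e k\<bar>)\<^sup>2)"
    by (intro sum_nonneg) simp
  then show "(\<Sum>i\<in>I. \<bar>e i\<bar>)\<^sup>2 \<le> card I * (\<Sum>i\<in>I. (e i)\<^sup>2)"
    unfolding lagrange_identity[of "\<lambda>i. \<bar>e i\<bar>" "\<lambda>_. 1"] by (simp add: mult.commute)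
qed

text \<open>The defect in Cauchy--Schwarz is half the sum of the squared differences of the
  \<open>\<bar>e i\<bar>\<close>, so it vanishes iff these all agree.\<close>

lemma sum_abs_upper_bound_eq_iff:
  fixes e :: "'i \<Rightarrow> real"
  assumes "finite I"
  shows "(\<Sum>i\<in>I. \<bar>e i\<bar>) = sqrt (card I * (\<Sum>i\<in>I. (e i)\<^sup>2)) \<longleftrightarrow>
    (\<forall>i\<in>I. \<forall>k\<in>I. (e i)\<^sup>2 = (e k)\<^sup>2)"
proof -
  have sqrt_eq: "x = sqrt y \<longleftrightarrow> x\<^sup>2 = y" if "0 \<le> x" "0 \<le> y" for x y
    using that by (metis real_sqrt_pow2 real_sqrt_unique)
  have "(\<Sum>i\<in>I. \<bar>e i\<bar>) = sqrt (card I * (\<Sum>i\<in>I. (e i)\<^sup>2)) \<longleftrightarrow>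
      (\<Sum>i\<in>I. \<bar>e i\<bar>)\<^sup>2 = card I * (\<Sum>i\<in>I. (e i)\<^sup>2)"
    by (rule sqrt_eq) (simp_all add: sum_nonneg)
  also have "\<dots> \<longleftrightarrow> (\<Sum>i\<in>I. \<Sum>k\<in>I. (\<bar>e i\<bar> * 1 - 1 * \<bar>e k\<bar>)\<^sup>2) = 0"
    unfolding lagrange_identity[of "\<lambda>i. \<bar>e i\<bar>" "\<lambda>_. 1"] by (auto simp: mult.commute)
  also have "\<dots> \<longleftrightarrow> (\<forall>i\<in>I. \<forall>k\<in>I. (e i)\<^sup>2 = (e k)\<^sup>2)"
    using assms by (simp add: sum_nonneg_eq_0_iff sum_nonneg power2_eq_iff abs_eq_iff)
  finally show ?thesis .
qed

text \<open>No two entries can share a strict sign, while a nonzero family with sum zero has entries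
  of both signs; so there is exactly one of each.\<close>

lemma opposite_pair_of_sum_zero:
  fixes e :: "'i \<Rightarrow> real"
  assumes "finite I" "(\<Sum>i\<in>I. e i) = 0"
    and neg: "\<And>i j. i \<in> I \<Longrightarrow> j \<in> I \<Longrightarrow> i \<noteq> j \<Longrightarrow> e i * e j \<le> 0"
    and "\<exists>i\<in>I. e i \<noteq> 0"
  obtains p q where "p \<in> I" "q \<in> I" "p \<noteq> q" "e p > 0" "e q = - e p"
    "\<forall>i\<in>I. i \<noteq> p \<longrightarrow> i \<noteq> q \<longrightarrow> e i = 0"
proof -
  obtain p where p: "p \<in> I" "e p > 0"
  proof -
    have "\<not> (\<forall>i\<in>I. e i \<le> 0)"
      using sum_nonneg_eq_0_iff[of I "\<lambda>i. - e i"] assms(1,2,4) by (auto simp: sum_negf)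
    then show ?thesis using that by force
  qed
  have le: "e i \<le> 0" if "i \<in> I" "i \<noteq> p" for i
    using neg[of i p] p that by (simp add: mult_le_0_iff)
  have rest: "(\<Sum>i\<in>I - {p}. e i) = - e p"
    using assms(1,2) p by (simp add: sum.remove)
  then obtain q where q: "q \<in> I - {p}" "e q \<noteq> 0"
    using p by (metis neg_0_equal_iff_equal order_less_irrefl sum.neutral)
  \<comment> \<open>Here \<open>e i \<le> 0\<close> and \<open>e q < 0\<close>, so
    \<open>e i * e q\<close> is nonnegative, but by hypothesis it is also at most 0.\<close>
  have zero: "e i = 0" if "i \<in> I" "i \<noteq> p" "i \<noteq> q" for i
    using neg[of i q] le[of i] le[of q] q that by (auto simp: mult_le_0_iff)
  have "(\<Sum>i\<in>I - {p}. e i) = e q"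
    using sum.remove[of "I - {p}" q e] assms(1) q zero by (simp add: sum.neutral)
  with rest p q zero show ?thesis
    by (intro that[of p q]) auto
qed

text \<open>Summing the Lagrange identity over all pairs of columns expresses the sum of all squared
  2 by 2 minors as twice the difference of the two sides of \<open>gram\<close>. Hence every minor
  vanishes.\<close>

lemma rank_one_of_gram:
  fixes x :: "'i \<Rightarrow> 'i \<Rightarrow> real"
  assumes "finite I"
    and gram: "(\<Sum>j\<in>I. \<Sum>l\<in>I. (\<Sum>i\<in>I. x i j * x i l)\<^sup>2) = (\<Sum>i\<in>I. \<Sum>j\<in>I. (x i j)\<^sup>2)\<^sup>2"
    and "i \<in> I" "j \<in> I" "k \<in> I" "l \<in> I"
  shows "x i j * x k l = x i l * x k j"
proof -
  have "(\<Sum>j\<in>I. \<Sum>l\<in>I. \<Sum>i\<in>I. \<Sum>k\<in>I. (x i j * x k l - x i l * x k j)\<^sup>2) =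
      2 * ((\<Sum>j\<in>I. \<Sum>i\<in>I. (x i j)\<^sup>2)\<^sup>2 - (\<Sum>j\<in>I. \<Sum>l\<in>I. (\<Sum>i\<in>I. x i j * x i l)\<^sup>2))"
    unfolding lagrange_identity
    by (simp add: power2_eq_square[of "sum _ _"] sum_product sum_subtractf flip: sum_distrib_left)
  also have "\<dots> = 0"
    using gram by (subst sum.swap) simp
  finally have "(x i j * x k l - x i l * x k j)\<^sup>2 = 0"
    using assms by (simp add: sum_nonneg_eq_0_iff sum_nonneg)
  then show ?thesis by simp
qed

context inverse_pair
begin

text \<open>With \<open>d p\<close> as the only possibly nonzero eigenvalue, the squared Frobenius
  norms of \<open>X\<close> and \<open>X * X\<close> are the second and fourth powers of
  \<open>d p\<close>. Since \<open>X\<close> is symmetric, \<open>X * X\<close> is its Gram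
  matrix.\<close>

lemma rank_one_triangular_form:
  assumes X: "triangular_form X d"
    and sym: "\<And>i j. i < n \<Longrightarrow> j < n \<Longrightarrow> X $$ (j, i) = X $$ (i, j)"
    and p: "p < n" "\<And>i. i < n \<Longrightarrow> i \<noteq> p \<Longrightarrow> d i = 0"
    and ijkl: "i < n" "j < n" "k < n" "l < n"
  shows "X $$ (i, j) * X $$ (k, l) = X $$ (i, l) * X $$ (k, j)"
proof (rule rank_one_of_gram[of "{..<n}" "\<lambda>i j. X $$ (i, j)"])
  \<comment> \<open>The exponent must be positive because \<open>0 ^ 0 = 1\<close>.\<close>
  have sum_d: "(\<Sum>i<n. d i ^ m) = d p ^ m" if "m > 0" for m
    using p sum.remove[of "{..<n}" p "\<lambda>i. d i ^ m"] that by (simp add: sum.neutral)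
  have Xn: "X \<in> carrier_mat n n"
    by (rule triangular_form_carrier[OF X])
  have XX: "(X * X) $$ (j, l) = (\<Sum>i<n. X $$ (i, j) * X $$ (i, l))" if "j < n" "l < n" for j l
    using mult_mat_sum[OF Xn Xn that] sym that by simp
  have "(\<Sum>j<n. \<Sum>l<n. (\<Sum>i<n. X $$ (i, j) * X $$ (i, l))\<^sup>2) =
      (\<Sum>j<n. \<Sum>l<n. ((X * X) $$ (j, l))\<^sup>2)"
    by (intro sum.cong refl) (simp add: XX del: index_mult_mat(1))
  also have "\<dots> = (\<Sum>i<n. (d i * d i)\<^sup>2)"
    by (rule frobenius_norm_triangular_form[OF triangular_form_mult[OF X X]])
      (simp add: XX mult.commute del: index_mult_mat(1))
  also have "\<dots> = (\<Sum>i<n. (d i)\<^sup>2)\<^sup>2"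
    using sum_d[of 4] sum_d[of 2] by (simp add: power_mult_distrib flip: power_add power_mult)
  also have "(\<Sum>i<n. (d i)\<^sup>2) = (\<Sum>i<n. \<Sum>j<n. (X $$ (i, j))\<^sup>2)"
    by (rule frobenius_norm_triangular_form[OF X sym, symmetric])
  finally show "(\<Sum>j<n. \<Sum>l<n. (\<Sum>i<n. X $$ (i, j) * X $$ (i, l))\<^sup>2) =
      (\<Sum>i<n. \<Sum>j<n. (X $$ (i, j))\<^sup>2)\<^sup>2" .
qed (use ijkl in auto)

end

text \<open>To be read with \<open>m\<close> as the matrix $M$ and \<open>y\<close> as $M^2$;
  \<open>plus\<close> and \<open>minus\<close> are minors of $M^2 + aM$ and $M^2 - aM$ in rows
  \<open>i\<close>, \<open>j\<close> and columns \<open>j\<close>, \<open>k\<close>. The exclusive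
  or says that non-adjacency is an equivalence relation with at most two classes.\<close>

lemma bipartition_of_rank_one_pair:
  fixes m y :: "'i \<Rightarrow> 'i \<Rightarrow> real"
  assumes "a \<noteq> 0"
    and sym: "\<And>i j. i \<in> I \<Longrightarrow> j \<in> I \<Longrightarrow> m j i = m i j \<and> y j i = y i j"
    and diag: "\<And>i. i \<in> I \<Longrightarrow> m i i = 0"
    and plus: "\<And>i j k. i \<in> I \<Longrightarrow> j \<in> I \<Longrightarrow> k \<in> I \<Longrightarrow>
      (y i j + a * m i j) * (y j k + a * m j k) = (y i k + a * m i k) * (y j j + a * m j j)"
    and minus: "\<And>i j k. i \<in> I \<Longrightarrow> j \<in> I \<Longrightarrow> k \<in> I \<Longrightarrow>
      (y i j - a * m i j) * (y j k - a * m j k) = (y i k - a * m i k) * (y j j - a * m j j)"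
    and no_zero_row: "\<And>i. i \<in> I \<Longrightarrow> \<exists>j\<in>I. m i j \<noteq> 0"
    and ijk: "i \<in> I" "j \<in> I" "k \<in> I"
  shows "m i k \<noteq> 0 \<longleftrightarrow> (m i j \<noteq> 0) \<noteq> (m j k \<noteq> 0)"
proof -
  \<comment> \<open>The case \<open>k = i\<close> of the minors, where the diagonal of
    \<open>m\<close> drops out. Comparing the two squares shows that \<open>y i j\<close> and
    \<open>m i j\<close> are never both nonzero.\<close>
  have sq: "(y i j + a * m i j)\<^sup>2 = y i i * y j j" "(y i j - a * m i j)\<^sup>2 = y i i * y j j"
    if "i \<in> I" "j \<in> I" for i j
    using plus[OF that that(1)] minus[OF that that(1)] sym[OF that] diag that
    by (simp_all add: power2_eq_square)
  have excl: "y i j = 0 \<or> m i j = 0" if "i \<in> I" "j \<in> I" for i j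
  proof -
    have "4 * a * (y i j * m i j) = (y i j + a * m i j)\<^sup>2 - (y i j - a * m i j)\<^sup>2"
      by (simp add: power2_eq_square algebra_simps)
    also have "\<dots> = 0" using sq[OF that] by simp
    finally show ?thesis using \<open>a \<noteq> 0\<close> by simp
  qed
  have nz: "y i i \<noteq> 0" if i: "i \<in> I" for i
  proof
    assume "y i i = 0"
    obtain j where j: "j \<in> I" "m i j \<noteq> 0" using no_zero_row[OF i] by blast
    then show False
      using sq(1)[OF i j(1)] excl[OF i j(1)] \<open>y i i = 0\<close> \<open>a \<noteq> 0\<close> by simp
  qed
  have one: "y i j \<noteq> 0 \<or> m i j \<noteq> 0" if "i \<in> I" "j \<in> I" for i j
    using sq(1)[OF that] nz that by auto
  \<comment> \<open>The difference of the two minors. As exactly one of \<open>y\<close> and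
    \<open>m\<close> is nonzero at each pair, the left side has no nonzero product if
    \<open>m i j\<close> and \<open>m j k\<close> are both zero or both nonzero, and exactly one
    otherwise.\<close>
  have "2 * a * (y i j * m j k + m i j * y j k) = 2 * a * (m i k * y j j)"
    using plus[OF ijk] minus[OF ijk] diag[OF ijk(2)] by (simp add: algebra_simps)
  then have "y i j * m j k + m i j * y j k = m i k * y j j"
    using \<open>a \<noteq> 0\<close> by simp
  then show ?thesis
    using excl[OF ijk(1,2)] excl[OF ijk(2,3)] one[OF ijk(1,2)] one[OF ijk(2,3)] nz[OF ijk(2)]
    by auto
qed

section \<open>The weighted graph\<close>

text \<open>Without parallel arcs, an arc leaving \<open>v\<close> is determined by its
  head.\<close>

lemma (in nomulti_digraph) out_degree_eq_card_neighbours: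
  "out_degree G v = card {w. v \<rightarrow>\<^bsub>G\<^esub> w}"
proof -
  have "{w. v \<rightarrow>\<^bsub>G\<^esub> w} = head G ` out_arcs G v"
    by (auto simp: arcs_ends_conv)
  moreover have "inj_on (head G) (out_arcs G v)"
    by (rule inj_onI, rule no_multi_arcs) (auto simp: arc_to_ends_def)
  ultimately show ?thesis
    by (simp add: out_degree_def card_image)
qed

text \<open>The fibre over each edge consists of its two orientations, which differ because there
  are no loops.\<close>

lemma (in graph) sum_arcs_ends_eq_twice_sum_edges:
  fixes h :: "'a set \<Rightarrow> real"
  shows "(\<Sum>(u, v)\<in>arcs_ends G. h {u, v}) = 2 * (\<Sum>e\<in>edges G. h e)"
proof -
  let ?f = "\<lambda>(u, v). {u, v}"
  have fin: "finite (arcs_ends G)"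
    by (simp add: arcs_ends_conv)
  have im: "?f ` arcs_ends G = edges G"
    by (auto simp: edges_def)
  have "(\<Sum>(u, v)\<in>arcs_ends G. h {u, v}) =
      (\<Sum>e\<in>edges G. \<Sum>p\<in>{p \<in> arcs_ends G. ?f p = e}. h (?f p))"
    using sum.image_gen[OF fin, of "\<lambda>p. h (?f p)" ?f] unfolding im by (simp add: case_prod_unfold)
  also have "\<dots> = (\<Sum>e\<in>edges G. 2 * h e)"
  proof (rule sum.cong[OF refl])
    fix e assume "e \<in> edges G"
    then obtain u v where uv: "e = {u, v}" "u \<rightarrow>\<^bsub>G\<^esub> v"
      by (auto simp: edges_def)
    have "v \<rightarrow>\<^bsub>G\<^esub> u"
      using arcs_ends_symmetric[OF sym_arcs uv(2)] .
    moreover have "u \<noteq> v"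
      using adj_not_same uv(2) by blast
    ultimately have "{p \<in> arcs_ends G. ?f p = e} = {(u, v), (v, u)}"
      using uv by (auto simp: doubleton_eq_iff)
    then show "(\<Sum>p\<in>{p \<in> arcs_ends G. ?f p = e}. h (?f p)) = 2 * h e"
      using \<open>u \<noteq> v\<close> uv(1) by (simp add: insert_commute)
  qed
  finally show ?thesis
    by (simp add: sum_distrib_left)
qed

text \<open>The matrix entry indexed by vertices instead of positions, so that the combinatorial
  arguments do not depend on the enumeration.\<close>

definition sombor_weight :: "('a, 'b) pre_digraph \<Rightarrow> 'a \<Rightarrow> 'a \<Rightarrow> real" where
  "sombor_weight G u v = (if u \<rightarrow>\<^bsub>G\<^esub> v
     then sqrt ((deg G u)\<^sup>2 + (deg G v)\<^sup>2) / (deg G u + deg G v) else 0)"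

context graph
begin

lemma adj_sym: "u \<rightarrow>\<^bsub>G\<^esub> v \<longleftrightarrow> v \<rightarrow>\<^bsub>G\<^esub> u"
  using arcs_ends_symmetric[OF sym_arcs] by blast

lemma finite_neighbours: "finite {w. v \<rightarrow>\<^bsub>G\<^esub> w}"
  by (rule finite_subset[OF _ finite_verts]) (auto dest: adj_in_verts)

lemma out_degree_pos: "u \<rightarrow>\<^bsub>G\<^esub> v \<Longrightarrow> 0 < out_degree G u"
  using finite_neighbours[of u] by (auto simp: out_degree_eq_card_neighbours card_gt_0_iff)

lemma sombor_weight_sym: "sombor_weight G v u = sombor_weight G u v"
  by (simp add: sombor_weight_def adj_sym[of u v] add.commute)

lemma sombor_weight_pos:
  assumes "u \<rightarrow>\<^bsub>G\<^esub> v"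
  shows "0 < sombor_weight G u v"
proof -
  have "0 < deg G u" "0 < deg G v"
    using assms adj_sym[of u v] by (auto dest: out_degree_pos)
  then show ?thesis
    using assms by (simp add: sombor_weight_def add_pos_pos)
qed

lemma sombor_weight_eq_0_iff: "sombor_weight G u v = 0 \<longleftrightarrow> \<not> u \<rightarrow>\<^bsub>G\<^esub> v"
proof (cases "u \<rightarrow>\<^bsub>G\<^esub> v")
  case True
  then show ?thesis using sombor_weight_pos[OF True] by simp
qed (simp add: sombor_weight_def)

lemma sombor_weight_nonneg: "0 \<le> sombor_weight G u v"
  by (simp add: sombor_weight_def)

lemma sum_sombor_weight_sq:
  "(\<Sum>u\<in>verts G. \<Sum>v\<in>verts G. (sombor_weight G u v)\<^sup>2) = 2 * diminished_sombor_edge_sum G"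
proof -
  let ?h = "\<lambda>e. (\<Sum>v\<in>e. (deg G v)\<^sup>2) / (\<Sum>v\<in>e. deg G v)\<^sup>2"
  have sub: "arcs_ends G \<subseteq> verts G \<times> verts G"
    by (auto dest: adj_in_verts)
  have "(\<Sum>u\<in>verts G. \<Sum>v\<in>verts G. (sombor_weight G u v)\<^sup>2) =
      (\<Sum>(u, v)\<in>verts G \<times> verts G. (sombor_weight G u v)\<^sup>2)"
    by (simp add: sum.cartesian_product)
  also have "\<dots> = (\<Sum>(u, v)\<in>arcs_ends G. (sombor_weight G u v)\<^sup>2)"
    using sub by (intro sum.mono_neutral_right) (auto simp: sombor_weight_def)
  also have "\<dots> = (\<Sum>(u, v)\<in>arcs_ends G. ?h {u, v})"
  proof (rule sum.cong[OF refl], clarify)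
    fix u v assume uv: "u \<rightarrow>\<^bsub>G\<^esub> v"
    then have "u \<noteq> v" using adj_not_same by blast
    with uv show "(sombor_weight G u v)\<^sup>2 = ?h {u, v}"
      by (simp add: sombor_weight_def power_divide)
  qed
  also have "\<dots> = 2 * diminished_sombor_edge_sum G"
    unfolding diminished_sombor_edge_sum_def by (rule sum_arcs_ends_eq_twice_sum_edges)
  finally show ?thesis .
qed

end

section \<open>Squares and cubes of the weights\<close>

context graph
begin

text \<open>Weights are nonnegative, so any walk of length two from \<open>u\<close> to
  \<open>v\<close> makes the corresponding entry of the square positive, and a scalar square forces
  \<open>u = v\<close>.\<close>

lemma sombor_weight_square_scalar_imp:
  assumes sq: "\<And>u v. u \<in> verts G \<Longrightarrow> v \<in> verts G \<Longrightarrow>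
      (\<Sum>w\<in>verts G. sombor_weight G u w * sombor_weight G w v) = (if u = v then c else 0)"
    and "arcs G \<noteq> {}" and u: "u \<in> verts G"
  shows "out_degree G u = 1"
proof -
  have pos: "0 < (\<Sum>w\<in>verts G. sombor_weight G u w * sombor_weight G w v)"
    if "u \<rightarrow>\<^bsub>G\<^esub> x" "x \<rightarrow>\<^bsub>G\<^esub> v" for u x v
    using that sombor_weight_pos adj_in_verts
    by (intro sum_pos2[of _ x]) (auto intro!: mult_nonneg_nonneg sombor_weight_nonneg)
  obtain x y where "x \<rightarrow>\<^bsub>G\<^esub> y"
    using \<open>arcs G \<noteq> {}\<close> by (auto simp: arcs_ends_conv)
  \<comment> \<open>The closed walk from \<open>x\<close> to \<open>y\<close> and back; a positive
    \<open>c\<close> then gives every vertex a neighbour.\<close>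
  then have "c > 0"
    using pos[of x y x] adj_sym[of x y] sq[of x x] adj_in_verts by simp
  then have "(\<Sum>w\<in>verts G. sombor_weight G u w * sombor_weight G w u) \<noteq> 0"
    using sq[OF u u] by simp
  then obtain w where w: "u \<rightarrow>\<^bsub>G\<^esub> w"
    by (rule sum.not_neutral_contains_not_neutral) (auto simp: sombor_weight_eq_0_iff)
  \<comment> \<open>Two neighbours of \<open>u\<close> are joined by a walk of length two through
    \<open>u\<close>.\<close>
  have "w' = w" if "u \<rightarrow>\<^bsub>G\<^esub> w'" for w'
    using pos[of w u w'] adj_sym[of u w] w that sq[of w w'] adj_in_verts
    by (auto split: if_splits)
  with w have "{w. u \<rightarrow>\<^bsub>G\<^esub> w} = {w}" by blast
  then show ?thesis
    by (simp add: out_degree_eq_card_neighbours)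
qed

text \<open>The only neighbour \<open>w\<close> of \<open>u\<close> has \<open>u\<close> as its only
  neighbour, so the only walk of length two from \<open>u\<close> returns to \<open>u\<close>; its
  two weights \<open>sqrt 2 / 2\<close> multiply to 1/2.\<close>

lemma sombor_weight_square_degree_one:
  assumes deg1: "\<And>v. v \<in> verts G \<Longrightarrow> out_degree G v = 1"
    and u: "u \<in> verts G" and v: "v \<in> verts G"
  shows "(\<Sum>w\<in>verts G. sombor_weight G u w * sombor_weight G w v) = (if u = v then 1 / 2 else 0)"
proof -
  obtain w where w: "{w. u \<rightarrow>\<^bsub>G\<^esub> w} = {w}"
    using deg1[OF u] by (auto simp: out_degree_eq_card_neighbours card_1_singleton_iff)
  then have uw: "u \<rightarrow>\<^bsub>G\<^esub> w" and wv: "w \<in> verts G"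
    using adj_in_verts by blast+
  have weight: "sombor_weight G x y = sqrt 2 / 2" if "x \<rightarrow>\<^bsub>G\<^esub> y" for x y
    using that deg1 adj_in_verts by (simp add: sombor_weight_def)
  have "(\<Sum>x\<in>verts G. sombor_weight G u x * sombor_weight G x v) =
      (\<Sum>x\<in>{w}. sombor_weight G u x * sombor_weight G x v)"
    using w wv by (intro sum.mono_neutral_right) (auto simp: sombor_weight_def)
  also have "\<dots> = (if u = v then 1 / 2 else 0)"
  proof (cases "w \<rightarrow>\<^bsub>G\<^esub> v")
    case True
    obtain z where "{x. w \<rightarrow>\<^bsub>G\<^esub> x} = {z}"
      using deg1[OF wv] by (auto simp: out_degree_eq_card_neighbours card_1_singleton_iff)
    then have "u = v"
      using True uw adj_sym[of u w] by (metis mem_Collect_eq singletonD)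
    then show ?thesis
      using True uw by (simp add: weight)
  next
    case False
    then show ?thesis
      using uw adj_sym[of u w] by (auto simp: sombor_weight_def)
  qed
  finally show ?thesis .
qed

text \<open>With indicators \<open>a\<close> and \<open>b\<close> of the parts, the entries of $M$
  are \<open>c * (a x * b y + b x * a y)\<close>. Those of $M^2$ are then
  \<open>c\<^sup>2 * (q * a y * a w + p * b y * b w)\<close>, and $M^3 = c^2 p q M$, where $c^2 p q$
  turns out to be the edge sum.\<close>

lemma sombor_weight_cube_complete_bipartite:
  assumes "complete_bipartite G" and u: "u \<in> verts G" and v: "v \<in> verts G"
  shows "(\<Sum>w\<in>verts G. (\<Sum>x\<in>verts G. sombor_weight G u x * sombor_weight G x w) * sombor_weight G w v)
    = diminished_sombor_edge_sum G * sombor_weight G u v"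
proof -
  obtain U V where UV: "verts G = U \<union> V" "U \<inter> V = {}" "arcs_ends G = U \<times> V \<union> V \<times> U"
    using assms(1) unfolding complete_bipartite_def complete_bipartite_digraph_def by blast
  have fin: "finite U" "finite V"
    using finite_verts UV(1) by auto
  define p q where "p = real (card U)" and "q = real (card V)"
  define a b :: "'a \<Rightarrow> real" where "a x = of_bool (x \<in> U)" and "b x = of_bool (x \<in> V)" for x
  define c where "c = sqrt (p\<^sup>2 + q\<^sup>2) / (p + q)"
  have nbU: "{y. x \<rightarrow>\<^bsub>G\<^esub> y} = V" if "x \<in> U" for x
    using UV that by auto
  have nbV: "{y. x \<rightarrow>\<^bsub>G\<^esub> y} = U" if "x \<in> V" for x
    using UV that by auto
  have \<mu>: "sombor_weight G x y = c * (a x * b y + b x * a y)" if "x \<in> verts G" "y \<in> verts G" for x y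
    using that UV nbU nbV
    by (auto simp: sombor_weight_def out_degree_eq_card_neighbours a_def b_def c_def p_def q_def
        add.commute)
  have sums: "(\<Sum>x\<in>verts G. a x) = p" "(\<Sum>x\<in>verts G. b x) = q"
    using fin unfolding UV(1) a_def b_def p_def q_def
    by (simp_all add: of_bool_def sum.If_cases Int_absorb1 Int_absorb2)
  have two: "(\<Sum>x\<in>verts G. sombor_weight G y x * sombor_weight G x w) =
      c\<^sup>2 * (a y * a w * q + b y * b w * p)" if "y \<in> verts G" "w \<in> verts G" for y w
  proof -
    have "sombor_weight G y x * sombor_weight G x w = c\<^sup>2 * (a y * a w * b x + b y * b w * a x)"
      if "x \<in> verts G" for x
      using that \<open>y \<in> verts G\<close> \<open>w \<in> verts G\<close> UV(1,2)
      by (auto simp: \<mu> a_def b_def power2_eq_square)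
    then show ?thesis
      by (simp add: sum.distrib sums flip: sum_distrib_left)
  qed
  \<comment> \<open>Twice the edge sum is the trace of the square, read off row by row from
    \<open>two\<close>; indicators satisfy \<open>a y * a y = a y\<close>.\<close>
  have "2 * diminished_sombor_edge_sum G = (\<Sum>y\<in>verts G. c\<^sup>2 * (a y * q + b y * p))"
    unfolding sum_sombor_weight_sq[symmetric]
  proof (rule sum.cong[OF refl])
    fix y assume y: "y \<in> verts G"
    have "(\<Sum>x\<in>verts G. (sombor_weight G y x)\<^sup>2) =
        (\<Sum>x\<in>verts G. sombor_weight G y x * sombor_weight G x y)"
      by (simp add: power2_eq_square sombor_weight_sym)
    then show "(\<Sum>x\<in>verts G. (sombor_weight G y x)\<^sup>2) = c\<^sup>2 * (a y * q + b y * p)"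
      by (simp add: two[OF y y]) (simp add: a_def b_def)
  qed
  also have "\<dots> = c\<^sup>2 * (p * q + q * p)"
    by (simp add: sum.distrib sums flip: sum_distrib_left sum_distrib_right)
  finally have S: "diminished_sombor_edge_sum G = c\<^sup>2 * (p * q)"
    by (simp add: algebra_simps)
  have "(\<Sum>w\<in>verts G. (\<Sum>x\<in>verts G. sombor_weight G u x * sombor_weight G x w) * sombor_weight G w v)
      = (\<Sum>w\<in>verts G. c ^ 3 * (a u * b v * q * a w + b u * a v * p * b w))"
  proof (rule sum.cong[OF refl])
    fix w assume w: "w \<in> verts G"
    then show "(\<Sum>x\<in>verts G. sombor_weight G u x * sombor_weight G x w) * sombor_weight G w v
        = c ^ 3 * (a u * b v * q * a w + b u * a v * p * b w)"
      using UV(1,2) unfolding two[OF u w] \<mu>[OF w v]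
      by (auto simp: a_def b_def power2_eq_square power3_eq_cube)
  qed
  also have "\<dots> = c ^ 3 * (a u * b v * q * p + b u * a v * p * q)"
    by (simp add: sum.distrib sums flip: sum_distrib_left)
  also have "\<dots> = diminished_sombor_edge_sum G * sombor_weight G u v"
    unfolding S \<mu>[OF u v] by (simp add: algebra_simps power2_eq_square power3_eq_cube)
  finally show ?thesis .
qed

end

section \<open>Passing between vertices and matrix positions\<close>

locale enumerated_graph = graph G for G :: "('a, 'b) pre_digraph" +
  fixes vs :: "'a list" and n :: nat
  assumes distinct_vs: "distinct vs" and set_vs: "set vs = verts G" and length_vs: "length vs = n"
begin

abbreviation M :: "real mat" where
  "M \<equiv> diminished_sombor_matrix G vs"

lemma M_carrier: "M \<in> carrier_mat n n"
  by (simp add: diminished_sombor_matrix_def length_vs)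

lemma M_entry: "i < n \<Longrightarrow> j < n \<Longrightarrow> M $$ (i, j) = sombor_weight G (vs ! i) (vs ! j)"
  by (simp add: diminished_sombor_matrix_def sombor_weight_def length_vs)

lemma M_sym: "i < n \<Longrightarrow> j < n \<Longrightarrow> M $$ (j, i) = M $$ (i, j)"
  by (simp add: M_entry sombor_weight_sym)

lemma M_diag: "i < n \<Longrightarrow> M $$ (i, i) = 0"
  using adj_not_same by (auto simp: M_entry sombor_weight_eq_0_iff)

lemma nth_verts: "i < n \<Longrightarrow> vs ! i \<in> verts G"
  using set_vs length_vs nth_mem by blast

lemma verts_nth:
  assumes "v \<in> verts G"
  obtains i where "i < n" "v = vs ! i"
  using assms set_vs length_vs by (metis in_set_conv_nth)

lemma all_nth_iff: "(\<forall>i<n. F (vs ! i)) \<longleftrightarrow> (\<forall>v\<in>verts G. F v)"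
  using set_vs length_vs by (metis in_set_conv_nth)

lemma nth_eq_iff: "i < n \<Longrightarrow> j < n \<Longrightarrow> vs ! i = vs ! j \<longleftrightarrow> i = j"
  using distinct_vs length_vs nth_eq_iff_index_eq by blast

lemma sum_nth: "(\<Sum>i<n. f (vs ! i)) = (\<Sum>v\<in>verts G. f v)"
  using sum.reindex_bij_betw[OF bij_betw_nth[OF distinct_vs], of "{..<n}" "verts G" f]
  by (simp add: set_vs length_vs)

lemma M_square: "i < n \<Longrightarrow> j < n \<Longrightarrow> (M * M) $$ (i, j) =
    (\<Sum>w\<in>verts G. sombor_weight G (vs ! i) w * sombor_weight G w (vs ! j))"
  unfolding mult_mat_sum[OF M_carrier M_carrier] sum_nth[symmetric]
  by (simp add: M_entry)

lemma M_cube: "i < n \<Longrightarrow> j < n \<Longrightarrow> (M * M * M) $$ (i, j) =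
    (\<Sum>w\<in>verts G. (\<Sum>x\<in>verts G. sombor_weight G (vs ! i) x * sombor_weight G x w)
      * sombor_weight G w (vs ! j))"
  unfolding mult_mat_sum[OF mult_carrier_mat[OF M_carrier M_carrier] M_carrier]
    sum_nth[of "\<lambda>w. (\<Sum>x\<in>verts G. sombor_weight G (vs ! i) x * sombor_weight G x w)
      * sombor_weight G w (vs ! j)", symmetric]
  by (intro sum.cong refl) (simp add: M_entry M_square del: index_mult_mat(1))

end

section \<open>The spectrum of the diminished Sombor matrix\<close>

locale spectral_graph = enumerated_graph G vs n + inverse_pair n P Q
  for G :: "('a, 'b) pre_digraph" and vs n P Q +
  fixes es :: "real list"
  assumes M_triangular: "triangular_form M (\<lambda>i. es ! i)" and length_es: "length es = n"
    and proots_M: "proots (char_poly M) = mset es"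
begin

lemma energy_eq: "diminished_sombor_energy G vs = (\<Sum>i<n. \<bar>es ! i\<bar>)"
proof -
  have "diminished_sombor_energy G vs = (\<Sum>x\<leftarrow>es. \<bar>x\<bar>)"
    by (simp add: diminished_sombor_energy_def proots_M flip: sum_mset_sum_list)
  then show ?thesis
    by (simp add: sum_list_sum_nth length_es atLeast0LessThan)
qed

lemma sum_eigenvalues: "(\<Sum>i<n. es ! i) = 0"
  using triangular_form_trace[OF M_triangular] M_carrier M_diag by (simp add: mat_trace_def)

lemma sum_eigenvalues_sq: "(\<Sum>i<n. (es ! i)\<^sup>2) = 2 * diminished_sombor_edge_sum G"
proof -
  have "(\<Sum>i<n. (es ! i)\<^sup>2) = (\<Sum>i<n. \<Sum>j<n. (sombor_weight G (vs ! i) (vs ! j))\<^sup>2)"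
    using frobenius_norm_triangular_form[OF M_triangular M_sym] by (simp add: M_entry)
  also have "\<dots> = (\<Sum>i<n. \<Sum>v\<in>verts G. (sombor_weight G (vs ! i) v)\<^sup>2)"
    by (simp only: sum_nth[of "\<lambda>v. (sombor_weight G (vs ! i) v)\<^sup>2" for i])
  also have "\<dots> = 2 * diminished_sombor_edge_sum G"
    by (simp only: sum_nth[of "\<lambda>u. \<Sum>v\<in>verts G. (sombor_weight G u v)\<^sup>2"] sum_sombor_weight_sq)
  finally show ?thesis .
qed

lemma M_square_sym: "i < n \<Longrightarrow> j < n \<Longrightarrow> (M * M) $$ (j, i) = (M * M) $$ (i, j)"
  by (simp add: M_square sombor_weight_sym mult.commute del: index_mult_mat(1))

text \<open>The symmetric matrix $M^2 - cI$ has the eigenvalues \<open>(es ! i)\<^sup>2 - c\<close>,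
  so these all vanish iff the matrix does.\<close>

lemma eigenvalues_sq_const_iff:
  "(\<forall>i<n. (es ! i)\<^sup>2 = c) \<longleftrightarrow> (\<forall>u\<in>verts G. \<forall>v\<in>verts G.
    (\<Sum>w\<in>verts G. sombor_weight G u w * sombor_weight G w v) = (if u = v then c else 0))"
proof -
  let ?X = "M * M + (- c) \<cdot>\<^sub>m 1\<^sub>m n"
  have MM: "M * M \<in> carrier_mat n n"
    by (rule mult_carrier_mat[OF M_carrier M_carrier])
  have X: "triangular_form ?X (\<lambda>i. es ! i * es ! i + (- c) * 1)"
    by (intro triangular_form_add triangular_form_mult triangular_form_smult
        triangular_form_one M_triangular)
  have entry: "?X $$ (i, j) = (M * M) $$ (i, j) - (if i = j then c else 0)" if "i < n" "j < n" for i j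
    using that MM by (simp del: index_mult_mat(1))
  have "(\<forall>i<n. (es ! i)\<^sup>2 = c) \<longleftrightarrow> (\<forall>i<n. es ! i * es ! i + (- c) * 1 = 0)"
    by (simp add: power2_eq_square)
  also have "\<dots> \<longleftrightarrow> (\<forall>i<n. \<forall>j<n. ?X $$ (i, j) = 0)"
    by (rule triangular_form_eq_0_iff[OF X]) (auto simp: entry M_square_sym simp del: index_mult_mat index_add_mat)
  also have "\<dots> \<longleftrightarrow> (\<forall>i<n. \<forall>j<n. (M * M) $$ (i, j) = (if vs ! i = vs ! j then c else 0))"
    by (simp add: entry nth_eq_iff del: index_mult_mat index_add_mat)
  also have "\<dots> \<longleftrightarrow> (\<forall>i<n. \<forall>j<n.
      (\<Sum>w\<in>verts G. sombor_weight G (vs ! i) w * sombor_weight G w (vs ! j))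
        = (if vs ! i = vs ! j then c else 0))"
    by (simp add: M_square del: index_mult_mat)
  also have "\<dots> \<longleftrightarrow> (\<forall>i<n. \<forall>v\<in>verts G.
      (\<Sum>w\<in>verts G. sombor_weight G (vs ! i) w * sombor_weight G w v)
        = (if vs ! i = v then c else 0))"
    by (subst all_nth_iff) (rule refl)
  also have "\<dots> \<longleftrightarrow> (\<forall>u\<in>verts G. \<forall>v\<in>verts G.
      (\<Sum>w\<in>verts G. sombor_weight G u w * sombor_weight G w v) = (if u = v then c else 0))"
    by (subst all_nth_iff) (rule refl)
  finally show ?thesis .
qed

lemma eigenvalues_sq_equal_iff:
  "(\<forall>i<n. \<forall>k<n. (es ! i)\<^sup>2 = (es ! k)\<^sup>2) \<longleftrightarrow>
    arcs G = {} \<or> (\<forall>v\<in>verts G. out_degree G v = 1)"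
proof
  assume "\<forall>i<n. \<forall>k<n. (es ! i)\<^sup>2 = (es ! k)\<^sup>2"
  \<comment> \<open>Index 0 is legitimate as soon as some \<open>i < n\<close> exists; for
    \<open>n = 0\<close> the claim is vacuous.\<close>
  then have "\<forall>i<n. (es ! i)\<^sup>2 = (es ! 0)\<^sup>2"
    by (meson le_less_trans zero_le)
  then have sq: "(\<Sum>w\<in>verts G. sombor_weight G u w * sombor_weight G w v)
      = (if u = v then (es ! 0)\<^sup>2 else 0)" if "u \<in> verts G" "v \<in> verts G" for u v
    unfolding eigenvalues_sq_const_iff using that by simp
  show "arcs G = {} \<or> (\<forall>v\<in>verts G. out_degree G v = 1)"
    using sombor_weight_square_scalar_imp[OF sq] by auto
next
  assume "arcs G = {} \<or> (\<forall>v\<in>verts G. out_degree G v = 1)"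
  then have "\<exists>c. \<forall>i<n. (es ! i)\<^sup>2 = c"
  proof
    assume "arcs G = {}"
    then have "\<forall>i<n. (es ! i)\<^sup>2 = 0"
      unfolding eigenvalues_sq_const_iff by (simp add: sombor_weight_def arcs_ends_conv)
    then show ?thesis ..
  next
    assume "\<forall>v\<in>verts G. out_degree G v = 1"
    then have "\<forall>i<n. (es ! i)\<^sup>2 = 1 / 2"
      unfolding eigenvalues_sq_const_iff
      by (intro ballI sombor_weight_square_degree_one) simp_all
    then show ?thesis ..
  qed
  then show "\<forall>i<n. \<forall>k<n. (es ! i)\<^sup>2 = (es ! k)\<^sup>2" by metis
qed

lemma energy_complete_bipartite:
  assumes "complete_bipartite G"
  shows "2 * sqrt (diminished_sombor_edge_sum G) = diminished_sombor_energy G vs"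
proof -
  define S where "S = diminished_sombor_edge_sum G"
  have S: "0 \<le> S"
    using sum_nonneg[of "{..<n}" "\<lambda>i. (es ! i)\<^sup>2"] sum_eigenvalues_sq by (simp add: S_def)
  let ?X = "M * M * M + (- S) \<cdot>\<^sub>m M"
  have X: "triangular_form ?X (\<lambda>i. es ! i * es ! i * es ! i + (- S) * es ! i)"
    by (intro triangular_form_add triangular_form_mult triangular_form_smult M_triangular)
  have zero: "?X $$ (i, j) = 0" if "i < n" "j < n" for i j
  proof -
    have "?X $$ (i, j) = (M * M * M) $$ (i, j) + (- S) * M $$ (i, j)"
      using that M_carrier by (simp del: index_mult_mat(1) assoc_mult_mat)
    also have "\<dots> = 0"
      unfolding M_cube[OF that] M_entry[OF that] S_def
        sombor_weight_cube_complete_bipartite[OF assms nth_verts[OF that(1)] nth_verts[OF that(2)]]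
      by simp
    finally show ?thesis .
  qed
  have "\<forall>i<n. es ! i * es ! i * es ! i + (- S) * es ! i = 0"
    by (rule iffD2[OF triangular_form_eq_0_iff[OF X]])
      (simp_all add: zero del: index_add_mat index_mult_mat assoc_mult_mat)
  then have root: "es ! i = 0 \<or> (es ! i)\<^sup>2 = S" if "i < n" for i
  proof -
    have "((es ! i)\<^sup>2 - S) * es ! i = 0"
      using \<open>\<forall>i<n. _\<close> that by (simp add: power2_eq_square algebra_simps)
    then show ?thesis by auto
  qed
  have abs: "\<bar>es ! i\<bar> * sqrt S = (es ! i)\<^sup>2" if "i < n" for i
    using root[OF that] by (auto simp: power2_eq_square)
  have "diminished_sombor_energy G vs * sqrt S = (\<Sum>i<n. \<bar>es ! i\<bar> * sqrt S)"
    by (simp only: energy_eq sum_distrib_right)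
  also have "\<dots> = (\<Sum>i<n. (es ! i)\<^sup>2)"
    by (intro sum.cong refl abs) simp
  finally have energy: "diminished_sombor_energy G vs * sqrt S = 2 * S"
    by (simp only: sum_eigenvalues_sq S_def)
  show ?thesis
  proof (cases "S = 0")
    case True
    then have "es ! i = 0" if "i < n" for i
      using root[OF that] by simp
    then show ?thesis
      using True by (simp add: energy_eq S_def)
  next
    case False
    then have "diminished_sombor_energy G vs * sqrt S = 2 * sqrt S * sqrt S"
      using energy S by simp
    then show ?thesis
      using False S by (simp add: S_def)
  qed
qed

text \<open>Connectedness enters only through the absence of isolated vertices in a graph with more
  than one vertex, which supplies the nonzero rows needed for the bipartition.\<close>

lemma complete_bipartite_of_energy_eq:
  assumes conn: "Digraph_Component.connected G"
    and eq: "2 * sqrt (diminished_sombor_edge_sum G) = diminished_sombor_energy G vs"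
  shows "complete_bipartite G"
proof -
  have reach: "u \<rightarrow>\<^sup>*\<^bsub>G\<^esub> v" if "u \<in> verts G" "v \<in> verts G" for u v
    using symmetric_connected_imp_strongly_connected[OF sym_arcs conn] that
    by (simp add: strongly_connected_def)
  obtain x where x: "x \<in> verts G"
    using conn by (auto simp: connected_conv)
  have nb: "\<exists>y. u \<rightarrow>\<^bsub>G\<^esub> y" if "u \<in> verts G" "verts G \<noteq> {u}" for u
  proof -
    obtain v where v: "v \<in> verts G" "v \<noteq> u"
      using \<open>u \<in> verts G\<close> \<open>verts G \<noteq> {u}\<close> by blast
    from reach[OF that(1) v(1)] v(2) show ?thesis
      by (cases rule: converse_reachable_cases) auto
  qed
  have "\<exists>U V. verts G = U \<union> V \<and> U \<inter> V = {} \<and> arcs_ends G = U \<times> V \<union> V \<times> U"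
  proof (cases "arcs G = {}")
    case True
    then have "verts G = {x}"
      using nb[OF x] by (auto simp: arcs_ends_conv)
    \<comment> \<open>The one-vertex graph, with the second part empty.\<close>
    with True show ?thesis
      by (intro exI[of _ "{x}"] exI[of _ "{}"]) (simp add: arcs_ends_conv)
  next
    case False
    then obtain y z where "y \<rightarrow>\<^bsub>G\<^esub> z"
      by (auto simp: arcs_ends_conv)
    then have yz: "y \<in> verts G" "z \<in> verts G" "y \<noteq> z" "y \<rightarrow>\<^bsub>G\<^esub> z"
      using adj_in_verts adj_not_same by blast+
    obtain i where i: "i < n" "y = vs ! i"
      using yz(1) by (rule verts_nth)
    obtain j where j: "j < n" "z = vs ! j"
      using yz(2) by (rule verts_nth)
    have "M $$ (i, j) \<noteq> 0"
      using yz(4) i j by (simp add: M_entry sombor_weight_eq_0_iff)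
    then have ex: "\<exists>i\<in>{..<n}. es ! i \<noteq> 0"
      using triangular_form_eq_0_iff[OF M_triangular M_sym] i(1) j(1) by auto
    have neg: "es ! i * es ! j \<le> 0" if "i \<in> {..<n}" "j \<in> {..<n}" "i \<noteq> j" for i j
      using sum_abs_lower_bound_eqD[OF _ sum_eigenvalues sum_eigenvalues_sq eq[unfolded energy_eq]] that
      by simp
    obtain p q where pq: "p \<in> {..<n}" "q \<in> {..<n}" "p \<noteq> q" "es ! p > 0" "es ! q = - es ! p"
      and zero: "\<forall>i\<in>{..<n}. i \<noteq> p \<longrightarrow> i \<noteq> q \<longrightarrow> es ! i = 0"
      by (rule opposite_pair_of_sum_zero[OF finite_lessThan sum_eigenvalues neg ex])
    define a where "a = es ! p"
    \<comment> \<open>Stated for any \<open>c\<close> and exceptional index \<open>r\<close> to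
      cover both signs: \<open>c = a\<close> with \<open>r = p\<close>, and \<open>c = - a\<close>
      with \<open>r = q\<close>.\<close>
    have rank_one: "((M * M) $$ (i, j) + c * M $$ (i, j)) * ((M * M) $$ (k, l) + c * M $$ (k, l)) =
        ((M * M) $$ (i, l) + c * M $$ (i, l)) * ((M * M) $$ (k, j) + c * M $$ (k, j))"
      if r: "r < n" "\<forall>i<n. i \<noteq> r \<longrightarrow> es ! i * es ! i + c * es ! i = 0"
        and ijkl: "i < n" "j < n" "k < n" "l < n" for c r i j k l
    proof -
      let ?X = "M * M + c \<cdot>\<^sub>m M"
      have X: "triangular_form ?X (\<lambda>i. es ! i * es ! i + c * es ! i)"
        by (intro triangular_form_add triangular_form_mult triangular_form_smult M_triangular)
      have entry: "?X $$ (i, j) = (M * M) $$ (i, j) + c * M $$ (i, j)" if "i < n" "j < n" for i j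
        using that M_carrier by (simp del: index_mult_mat(1))
      have sym: "?X $$ (j, i) = ?X $$ (i, j)" if "i < n" "j < n" for i j
        using entry M_sym M_square_sym that by (simp only:)
      have "?X $$ (i, j) * ?X $$ (k, l) = ?X $$ (i, l) * ?X $$ (k, j)"
        by (rule rank_one_triangular_form[OF X _ r(1) _ ijkl])
          (erule (1) sym, erule (1) r(2)[rule_format])
      then show ?thesis
        using ijkl by (simp only: entry)
    qed
    have bip: "M $$ (i, k) \<noteq> 0 \<longleftrightarrow> (M $$ (i, j) \<noteq> 0) \<noteq> (M $$ (j, k) \<noteq> 0)"
      if "i < n" "j < n" "k < n" for i j k
    proof (rule bipartition_of_rank_one_pair[of a "{..<n}" "\<lambda>i j. M $$ (i, j)" "\<lambda>i j. (M * M) $$ (i, j)"])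
      show "a \<noteq> 0" using pq by (simp add: a_def)
      show "M $$ (j, i) = M $$ (i, j) \<and> (M * M) $$ (j, i) = (M * M) $$ (i, j)"
        if "i \<in> {..<n}" "j \<in> {..<n}" for i j
        using that M_sym M_square_sym by simp
      show "M $$ (i, i) = 0" if "i \<in> {..<n}" for i
        using that M_diag by simp
      fix i assume i: "i \<in> {..<n}"
      have "verts G \<noteq> {vs ! i}"
        using yz(1-3) by (metis singletonD)
      then obtain w where w: "vs ! i \<rightarrow>\<^bsub>G\<^esub> w"
        using nb[of "vs ! i"] nth_verts i by blast
      obtain j where "j < n" "w = vs ! j"
        using adj_in_verts(2)[OF w] by (rule verts_nth)
      then show "\<exists>j\<in>{..<n}. M $$ (i, j) \<noteq> 0"
        using w i by (auto simp: M_entry sombor_weight_eq_0_iff)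
      fix j k assume "j \<in> {..<n}" "k \<in> {..<n}"
      with i have ijk: "i < n" "j < n" "k < n" by simp_all
      show "((M * M) $$ (i, j) + a * M $$ (i, j)) * ((M * M) $$ (j, k) + a * M $$ (j, k)) =
          ((M * M) $$ (i, k) + a * M $$ (i, k)) * ((M * M) $$ (j, j) + a * M $$ (j, j))"
      proof -
        \<comment> \<open>The polynomial $t^2 + at$ kills the eigenvalues 0 and $-a$, so only index
          \<open>p\<close> survives; for $t^2 - at$ it is index \<open>q\<close>.\<close>
        have "es ! i * es ! i + a * es ! i = 0" if "i < n" "i \<noteq> p" for i
          using that zero pq by (cases "i = q") (auto simp: a_def)
        then have root: "\<forall>i<n. i \<noteq> p \<longrightarrow> es ! i * es ! i + a * es ! i = 0"
          by blast
        show ?thesis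
          by (rule rank_one[OF _ root ijk(1,2,2,3)]) (use pq in simp)
      qed
      show "((M * M) $$ (i, j) - a * M $$ (i, j)) * ((M * M) $$ (j, k) - a * M $$ (j, k)) =
          ((M * M) $$ (i, k) - a * M $$ (i, k)) * ((M * M) $$ (j, j) - a * M $$ (j, j))"
      proof -
        have "es ! i * es ! i + (- a) * es ! i = 0" if "i < n" "i \<noteq> q" for i
          using that zero pq by (cases "i = p") (auto simp: a_def)
        then have root: "\<forall>i<n. i \<noteq> q \<longrightarrow> es ! i * es ! i + (- a) * es ! i = 0"
          by blast
        show ?thesis
          using rank_one[OF _ root ijk(1,2,2,3)] pq(2)
          by (simp only: mult_minus_left add_uminus_conv_diff lessThan_iff simp_thms)
      qed
    qed (use that in auto)
    have adj: "u \<rightarrow>\<^bsub>G\<^esub> v \<longleftrightarrow> (u \<rightarrow>\<^bsub>G\<^esub> w) \<noteq> (w \<rightarrow>\<^bsub>G\<^esub> v)"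
      if uvw: "u \<in> verts G" "v \<in> verts G" "w \<in> verts G" for u v w
    proof -
      obtain i where i: "i < n" "u = vs ! i"
        using uvw(1) by (rule verts_nth)
      obtain k where k: "k < n" "v = vs ! k"
        using uvw(2) by (rule verts_nth)
      obtain j where j: "j < n" "w = vs ! j"
        using uvw(3) by (rule verts_nth)
      show ?thesis
        using bip[OF i(1) j(1) k(1)]
        by (simp only: M_entry i j k sombor_weight_eq_0_iff not_not)
    qed
    \<comment> \<open>Taking \<open>x\<close> as the intermediate vertex in \<open>adj\<close>, two
      vertices are adjacent iff exactly one of them is a neighbour of \<open>x\<close>. So
      \<open>N\<close> and its complement, which contains \<open>x\<close>, are the parts.\<close>
    define N where "N = {v \<in> verts G. x \<rightarrow>\<^bsub>G\<^esub> v}"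
    have "(u, v) \<in> arcs_ends G \<longleftrightarrow> u \<in> verts G \<and> v \<in> verts G \<and> (u \<in> N) \<noteq> (v \<in> N)" for u v
      using adj[of u v x] x adj_sym[of u x] adj_in_verts[of u v] unfolding N_def by blast
    moreover have "N \<subseteq> verts G"
      by (auto simp: N_def)
    ultimately show ?thesis
      by (intro exI[of _ "verts G - N"] exI[of _ N]) auto
  qed
  then show ?thesis
    using graph_axioms unfolding complete_bipartite_def complete_bipartite_digraph_def by blast
qed

end

section \<open>Both bounds and their equality cases\<close>

theorem theorem4p2:
  fixes G :: "('a, 'b) pre_digraph" and vs :: "'a list" and n :: nat
  assumes "graph G"
    and "distinct vs" and "set vs = verts G" and "length vs = n"
  shows "2 * sqrt (diminished_sombor_edge_sum G) \<le> diminished_sombor_energy G vs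
    \<and> diminished_sombor_energy G vs \<le> sqrt (2 * real n * diminished_sombor_edge_sum G)
    \<and> (diminished_sombor_energy G vs = sqrt (2 * real n * diminished_sombor_edge_sum G)
         \<longleftrightarrow> arcs G = {} \<or> (\<forall>v\<in>verts G. out_degree G v = 1))
    \<and> (Digraph_Component.connected G \<longrightarrow>
         (2 * sqrt (diminished_sombor_edge_sum G) = diminished_sombor_energy G vs \<longleftrightarrow> complete_bipartite G))"
proof -
  interpret enumerated_graph G vs n
    using assms by (simp add: enumerated_graph_def enumerated_graph_axioms_def)
  obtain P Q es where PQ: "inverse_pair n P Q" "inverse_pair.triangular_form n P Q M (\<lambda>i. es ! i)"
    "length es = n" "proots (char_poly M) = mset es"
    by (rule real_symmetric_triangular_form[OF M_carrier M_sym])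
  interpret spectral_graph G vs n P Q es
    using PQ enumerated_graph_axioms by (simp add: spectral_graph_def spectral_graph_axioms_def)
  let ?S = "diminished_sombor_edge_sum G"
  \<comment> \<open>Rewrites the bound in Cauchy--Schwarz form, using that the squared eigenvalues
    sum to twice the edge sum.\<close>
  have bound: "sqrt (2 * real n * ?S) = sqrt (card {..<n} * (\<Sum>i<n. (es ! i)\<^sup>2))"
    by (simp add: sum_eigenvalues_sq)
  have "2 * sqrt ?S \<le> diminished_sombor_energy G vs"
    unfolding energy_eq by (rule sum_abs_lower_bound[OF _ sum_eigenvalues sum_eigenvalues_sq]) simp
  moreover have "diminished_sombor_energy G vs \<le> sqrt (2 * real n * ?S)"
    unfolding energy_eq bound by (rule sum_abs_upper_bound)
  moreover have "diminished_sombor_energy G vs = sqrt (2 * real n * ?S) \<longleftrightarrow>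
      arcs G = {} \<or> (\<forall>v\<in>verts G. out_degree G v = 1)"
    unfolding energy_eq bound eigenvalues_sq_equal_iff[symmetric]
    by (subst sum_abs_upper_bound_eq_iff) auto
  ultimately show ?thesis
    using complete_bipartite_of_energy_eq energy_complete_bipartite by blast
qed

end
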